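(* Let $p$ and $q$ be probability distributions on $\mathbb{Z}_+=\{0,1,2,\dots\}$ with finite nonzero means. Assume that $p \le_{\rm icv} q$, $p(0)=q(0)$, and $\eta(q^\circ)\le e^{-2}$. Then $\zeta_{\rm CM}(p)\le \zeta_{\rm CM}(q)$.
   Context: For a probability distribution $p$ on $\mathbb{Z}_+$ (the same symbol denotes its probability mass function), $G_p(s)=\sum_{k\ge 0}s^k p(k)$, $s\in[0,1]$, is its generating function, and $\eta(p)=\inf\{s\ge 0: G_p(s)=s\}$ is the smallest fixed point of $G_p$ in $[0,1]$. If $p$ has finite nonzero mean $m_1(p)=\sum_k k\,p(k)$, its downshifted size biasing is the probability distribution $p^\circ$ on $\mathbb{Z}_+$ given by $p^\circ(k)=\frac{(k+1)p(k+1)}{m_1(p)}$, and the configuration model branching functional is $\zeta_{\rm CM}(p)=1-G_p(\eta(p^\circ))$. The increasing concave order $\mu\le_{\rm icv}\nu$ between probability distributions on $\mathbb{R}$ (or a subset) means that $\int\phi\,d\mu\le\int\phi\,d\nu$ for all increasing (nondecreasing) concave functions $\phi:\mathbb{R}\to\mathbb{R}$ such that both integrals exist. *)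

theory Defs
  imports "HOL-Probability.Probability"
begin

definition gen_fun :: "nat pmf \<Rightarrow> real \<Rightarrow> real" where
  "gen_fun p s = (\<Sum>k. s ^ k * pmf p k)"

text \<open>The generating function is only meaningful on the unit interval, so the infimum is
  restricted to it. Since 1 is always a fixed point, this does not change its value.\<close>

definition eta :: "nat pmf \<Rightarrow> real" where
  "eta p = Inf {s \<in> {0..1}. gen_fun p s = s}"

definition finite_mean :: "nat pmf \<Rightarrow> bool" where
  "finite_mean p \<longleftrightarrow> integrable (measure_pmf p) real"

definition mean :: "nat pmf \<Rightarrow> real" where
  "mean p = measure_pmf.expectation p real"

text \<open>Downshifted size biasing. It is a genuine distribution with the displayed mass function
  only when the mean is finite and nonzero; see \<open>pmf_size_bias\<close> below.\<close>

definition size_bias :: "nat pmf \<Rightarrow> nat pmf" where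
  "size_bias p = embed_pmf (\<lambda>k. real (k + 1) * pmf p (k + 1) / mean p)"

lemma pmf_size_bias:
  assumes "finite_mean p" and "mean p \<noteq> 0"
  shows "pmf (size_bias p) k = real (k + 1) * pmf p (k + 1) / mean p"
proof -
  have mean_pos: "mean p > 0"
    using assms(2) by (simp add: mean_def less_le)
  have int: "integrable (count_space UNIV) (\<lambda>k. pmf p k * real k)"
    using assms(1) unfolding finite_mean_def
    by (subst (asm) measure_pmf_eq_density, subst (asm) integrable_density) auto
  have eq: "mean p = (\<integral>k. pmf p k * real k \<partial>count_space UNIV)"
    unfolding mean_def by (subst measure_pmf_eq_density, subst integral_density) auto
  have "(\<lambda>k. pmf p k * real k) sums mean p"
    using int unfolding eq by (rule sums_integral_count_space_nat)
  hence "(\<lambda>k. pmf p (k + 1) * real (k + 1)) sums mean p"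
    using sums_Suc_iff[of "\<lambda>k. pmf p k * real k" "mean p"] by simp
  hence "(\<lambda>k. pmf p (k + 1) * real (k + 1) / mean p) sums (mean p / mean p)"
    by (rule sums_divide)
  hence sums: "(\<lambda>k. real (k + 1) * pmf p (k + 1) / mean p) sums 1"
    using mean_pos by (simp add: mult.commute)
  have "(\<integral>\<^sup>+k. ennreal (real (k + 1) * pmf p (k + 1) / mean p) \<partial>count_space UNIV)
      = (\<Sum>k. ennreal (real (k + 1) * pmf p (k + 1) / mean p))"
    by (rule nn_integral_count_space_nat)
  also have "\<dots> = ennreal 1"
    using mean_pos sums by (intro suminf_ennreal_eq) auto
  finally show ?thesis
    unfolding size_bias_def using mean_pos by (intro pmf_embed_pmf) auto
qed

definition zeta_CM :: "nat pmf \<Rightarrow> real" where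
  "zeta_CM p = 1 - gen_fun p (eta (size_bias p))"

definition icv_le :: "real pmf \<Rightarrow> real pmf \<Rightarrow> bool" where
  "icv_le \<mu> \<nu> \<longleftrightarrow>
     (\<forall>\<phi> :: real \<Rightarrow> real. mono \<phi> \<longrightarrow> concave_on UNIV \<phi> \<longrightarrow>
        integrable (measure_pmf \<mu>) \<phi> \<longrightarrow> integrable (measure_pmf \<nu>) \<phi> \<longrightarrow>
        measure_pmf.expectation \<mu> \<phi> \<le> measure_pmf.expectation \<nu> \<phi>)"

end

theory Submission
  imports Defs
begin

text \<open>
  Testing the order against the decreasing convex functions \<open>x \<mapsto> s\<^sup>x\<close> gives
  \<open>G\<^sub>q \<le> G\<^sub>p\<close>, so it suffices to show \<open>\<eta>(q\<degree>) \<le> \<eta>(p\<degree>)\<close>. For \<open>s \<le> e\<^sup>-\<^sup>2\<close> the function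
  \<open>x \<mapsto> x s\<^bsup>x-1\<^esup>\<close> is decreasing and convex on \<open>[1,\<infinity>)\<close>, and it may be replaced on
  \<open>(-\<infinity>,1]\<close> by its tangent at \<open>1\<close>, because \<open>p(0) = q(0)\<close> makes its value at \<open>0\<close> irrelevant.
  Hence \<open>G\<^sub>p'(s) \<ge> G\<^sub>q'(s)\<close>, and dividing by the means, which are ordered the same way as \<open>p\<close>
  and \<open>q\<close>, gives \<open>G\<^bsub>p\<degree>\<^esub> \<ge> G\<^bsub>q\<degree>\<^esub>\<close> on \<open>[0, e\<^sup>-\<^sup>2]\<close>. A fixed point of
  \<open>G\<^bsub>p\<degree>\<^esub>\<close> below \<open>\<eta>(q\<degree>) \<le> e\<^sup>-\<^sup>2\<close> would then force one of \<open>G\<^bsub>q\<degree>\<^esub>\<close> there.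
\<close>

section \<open>Generating functions as expectations and power series\<close>

lemma sums_expectation_nat_pmf:
  fixes h :: "nat \<Rightarrow> real"
  assumes "integrable (measure_pmf p) h"
  shows "(\<lambda>k. pmf p k * h k) sums measure_pmf.expectation p h"
proof -
  have int: "integrable (count_space UNIV) (\<lambda>k. pmf p k * h k)"
    using assms by (subst (asm) measure_pmf_eq_density, subst (asm) integrable_density) auto
  have "measure_pmf.expectation p h = (\<integral>k. pmf p k * h k \<partial>count_space UNIV)"
    by (subst measure_pmf_eq_density, subst integral_density) auto
  with sums_integral_count_space_nat[OF int] show ?thesis by simp
qed

lemma integrable_affine_bound:
  fixes h :: "nat \<Rightarrow> real"
  assumes "finite_mean p" and "\<And>k. \<bar>h k\<bar> \<le> C + real k"
  shows "integrable (measure_pmf p) h"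
proof (rule Bochner_Integration.integrable_bound)
  show "integrable (measure_pmf p) (\<lambda>k. C + real k)"
    using assms(1) by (simp add: finite_mean_def)
  show "AE k in measure_pmf p. norm (h k) \<le> norm (C + real k)"
    using assms(2) by (fastforce intro: AE_I2 order_trans)
qed simp

lemma integrable_power_pmf:
  assumes "0 \<le> s" "s \<le> (1::real)"
  shows "integrable (measure_pmf p) (\<lambda>k::nat. s ^ k)"
  using assms
  by (intro measure_pmf.integrable_const_bound[where B = 1]) (auto simp: power_le_one)

lemma gen_fun_sums:
  assumes "0 \<le> s" "s \<le> 1"
  shows "(\<lambda>k. s ^ k * pmf p k) sums gen_fun p s"
  using sums_expectation_nat_pmf[OF integrable_power_pmf[OF assms], of p]
  by (auto simp: gen_fun_def mult.commute sums_iff)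

lemma gen_fun_eq_expectation:
  assumes "0 \<le> s" "s \<le> 1"
  shows "gen_fun p s = measure_pmf.expectation p (\<lambda>k. s ^ k)"
  using sums_expectation_nat_pmf[OF integrable_power_pmf[OF assms], of p]
  by (auto simp: gen_fun_def mult.commute sums_iff)

lemma gen_fun_0: "gen_fun p 0 = pmf p 0"
proof -
  have "(\<lambda>k. 0 ^ k * pmf p k) = (\<lambda>k. if k = 0 then pmf p k else 0)"
    by (auto simp: fun_eq_iff)
  then show ?thesis
    using sums_unique[OF sums_single[of 0 "pmf p"]] by (simp add: gen_fun_def)
qed

lemma gen_fun_1: "gen_fun p 1 = 1"
  by (simp add: gen_fun_eq_expectation)

lemma gen_fun_mono:
  assumes "0 \<le> s" "s \<le> t" "t \<le> 1"
  shows "gen_fun p s \<le> gen_fun p t"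
  using assms
  by (auto simp: gen_fun_eq_expectation power_mono intro!: integral_mono integrable_power_pmf)

text \<open>The coefficients are summable, so the radius of convergence is at least 1 and
  \<open>t < 1\<close> keeps the interval strictly inside the disc.\<close>

lemma continuous_on_gen_fun:
  assumes "t < 1"
  shows "continuous_on {0..t} (gen_fun p)"
proof (intro continuous_at_imp_continuous_on ballI)
  fix x assume x: "x \<in> {0..t}"
  have "summable (\<lambda>k. pmf p k * 1 ^ k)"
    using gen_fun_sums[of 1 p] by (simp add: sums_iff)
  then have "isCont (\<lambda>x. \<Sum>k. pmf p k * x ^ k) x"
    by (rule isCont_powser) (use x assms in auto)
  then show "isCont (gen_fun p) x"
    by (simp add: gen_fun_def[abs_def] mult.commute)
qed

section \<open>Smallest fixed points and size biasing\<close>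

lemma eta_le:
  assumes "0 \<le> s" "s \<le> 1" "gen_fun p s = s"
  shows "eta p \<le> s"
  unfolding eta_def by (rule cInf_lower) (use assms in \<open>auto intro: bdd_belowI[of _ 0]\<close>)

lemma eta_greatest:
  assumes "\<And>s. \<lbrakk>0 \<le> s; s \<le> 1; gen_fun p s = s\<rbrakk> \<Longrightarrow> c \<le> s"
  shows "c \<le> eta p"
  unfolding eta_def
proof (rule cInf_greatest)
  have "1 \<in> {s \<in> {0..1}. gen_fun p s = s}" by (simp add: gen_fun_1)
  then show "{s \<in> {0..1}. gen_fun p s = s} \<noteq> {}" by blast
qed (use assms in auto)

lemma eta_bounds: "0 \<le> eta p" "eta p \<le> 1"
  by (auto intro: eta_greatest eta_le simp: gen_fun_1)

text \<open>The difference \<open>s - gen_fun p s\<close> is \<open>- pmf p 0\<close> at 0 and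
  nonnegative at \<open>t\<close>, so it vanishes somewhere in between.\<close>

lemma eta_le_of_gen_fun_le:
  assumes "0 \<le> t" "t \<le> 1" "gen_fun p t \<le> t"
  shows "eta p \<le> t"
proof (cases "t = 1")
  case False
  let ?f = "\<lambda>s. s - gen_fun p s"
  have "\<exists>s\<ge>0. s \<le> t \<and> ?f s = 0"
    using assms False
    by (intro IVT') (auto simp: gen_fun_0 intro!: continuous_intros continuous_on_gen_fun)
  then obtain s where s: "0 \<le> s" "s \<le> t" "gen_fun p s = s" by auto
  with assms show ?thesis using eta_le[of s p] by linarith
qed (simp add: eta_bounds)

text \<open>This is the identity of the size-biased generating function with the derivative of
  \<open>gen_fun p\<close> divided by the mean. At \<open>k = 0\<close> the factor
  \<open>real k\<close> hides the truncated exponent \<open>k - 1\<close>.\<close>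

lemma gen_fun_size_bias:
  assumes "finite_mean p" "mean p \<noteq> 0" "0 \<le> s" "s \<le> 1"
  shows "integrable (measure_pmf p) (\<lambda>k. real k * s ^ (k - 1))"
    and "gen_fun (size_bias p) s = measure_pmf.expectation p (\<lambda>k. real k * s ^ (k - 1)) / mean p"
proof -
  show int: "integrable (measure_pmf p) (\<lambda>k. real k * s ^ (k - 1))"
    using assms
    by (intro integrable_affine_bound[where C = 0]) (auto simp: abs_mult power_le_one mult_left_le)
  let ?E = "measure_pmf.expectation p (\<lambda>k. real k * s ^ (k - 1))"
  have "(\<lambda>k. pmf p (Suc k) * (real (Suc k) * s ^ k)) sums ?E"
    using sums_expectation_nat_pmf[OF int]
      sums_Suc_iff[of "\<lambda>k. pmf p k * (real k * s ^ (k - 1))" ?E] by simp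
  then have "(\<lambda>k. pmf p (Suc k) * (real (Suc k) * s ^ k) / mean p) sums (?E / mean p)"
    by (rule sums_divide)
  then show "gen_fun (size_bias p) s = ?E / mean p"
    using assms(1,2) by (simp add: gen_fun_def pmf_size_bias sums_iff mult_ac)
qed

section \<open>Comparisons drawn from the order\<close>

lemma icv_leD:
  fixes f :: "real \<Rightarrow> real"
  assumes "icv_le (map_pmf real p) (map_pmf real q)" "convex_on UNIV f" "antimono f"
    and "integrable (measure_pmf p) (\<lambda>k. f (real k))"
    and "integrable (measure_pmf q) (\<lambda>k. f (real k))"
  shows "measure_pmf.expectation q (\<lambda>k. f (real k)) \<le> measure_pmf.expectation p (\<lambda>k. f (real k))"
proof -
  have "mono (\<lambda>x. - f x)" using assms(3) by (auto simp: monotone_on_def)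
  moreover have "concave_on UNIV (\<lambda>x. - f x)" using assms(2) by (simp add: convex_on_iff_concave)
  ultimately show ?thesis
    using assms(1)[unfolded icv_le_def, rule_format, of "\<lambda>x. - f x"] assms(4,5) by simp
qed

lemma icv_le_mean_le:
  assumes "icv_le (map_pmf real p) (map_pmf real q)" "finite_mean p" "finite_mean q"
  shows "mean p \<le> mean q"
  using icv_leD[OF assms(1), of uminus] assms(2,3)
  by (simp add: antimono_def finite_mean_def mean_def convex_on_def)

lemma convex_on_powr_base:
  assumes "0 < s"
  shows "convex_on UNIV (\<lambda>x. s powr x :: real)"
proof (rule convex_on_realI)
  fix x show "((powr) s has_real_derivative s powr x * ln s) (at x)"
    using assms by (auto intro!: derivative_eq_intros)
next
  fix x y :: real assume "x \<le> y"
  show "s powr x * ln s \<le> s powr y * ln s"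
  proof (cases "s \<le> 1")
    case True
    then show ?thesis using assms \<open>x \<le> y\<close>
      by (intro mult_right_mono_neg powr_mono') auto
  next
    case False
    then show ?thesis using \<open>x \<le> y\<close> by (intro mult_right_mono powr_mono) auto
  qed
qed auto

lemma gen_fun_le_of_icv_le:
  assumes "icv_le (map_pmf real p) (map_pmf real q)" "pmf p 0 = pmf q 0" "0 \<le> s" "s \<le> 1"
  shows "gen_fun q s \<le> gen_fun p s"
\<comment> \<open>At \<open>s = 0\<close> the power \<open>s ^ 0\<close> is 1 but
  \<open>s powr 0\<close> is 0, so this case rests on the equal masses at 0.\<close>
proof (cases "s = 0")
  case False
  with assms have "0 < s" by simp
  have "antimono (\<lambda>x. s powr x)"
    using \<open>0 < s\<close> \<open>s \<le> 1\<close> by (auto intro!: antimonoI powr_mono')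
  from icv_leD[OF assms(1) convex_on_powr_base[OF \<open>0 < s\<close>] this] show ?thesis
    using \<open>0 < s\<close> assms(4) by (simp add: gen_fun_eq_expectation powr_realpow integrable_power_pmf)
qed (use assms in \<open>simp add: gen_fun_0\<close>)

text \<open>The tangent extension degenerates at \<open>s = 0\<close>, where \<open>max 0 (2 - x)\<close> serves instead.\<close>

lemma size_bias_test_function:
  assumes "0 \<le> s" "s \<le> exp (- 2)"
  obtains f :: "real \<Rightarrow> real" where "convex_on UNIV f" "antimono f"
    "\<And>k::nat. k > 0 \<Longrightarrow> f (real k) = real k * s ^ (k - 1)"
proof (cases "s = 0")
  case True
  show thesis
  proof
    show "convex_on UNIV (\<lambda>x::real. max 0 (2 - x))"
    proof (intro convex_onI convex_UNIV)
      fix u x y :: real assume "0 < u" "u < 1"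
      then have "(1 - u) * (2 - x) \<le> (1 - u) * max 0 (2 - x)" "u * (2 - y) \<le> u * max 0 (2 - y)"
        "0 \<le> (1 - u) * max 0 (2 - x)" "0 \<le> u * max 0 (2 - y)"
        by (auto intro!: mult_left_mono)
      then show "max 0 (2 - ((1 - u) *\<^sub>R x + u *\<^sub>R y))
          \<le> (1 - u) * max 0 (2 - x) + u * max 0 (2 - y)"
        by (intro max.boundedI) (simp_all add: algebra_simps)
    qed
    show "antimono (\<lambda>x::real. max 0 (2 - x))" by (auto simp: antimono_def)
    fix k :: nat assume "k > 0"
    then show "max 0 (2 - real k) = real k * s ^ (k - 1)"
      using True by (cases "k = 1") auto
  qed
next
  case False
  then have s: "0 < s" using assms by simp
  define L where "L = ln s"
  have L: "L \<le> -2" using assms(2) s ln_mono[of s "exp (-2)"] by (simp add: L_def)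
  \<comment> \<open>The right branch has value 1 and slope \<open>1 + L\<close> at 1, so the two
    pieces join differentiably.\<close>
  define f where "f = (\<lambda>x. if x \<in> {..1} then 1 + (1 + L) * (x - 1) else x * s powr (x - 1))"
  define f' where "f' = (\<lambda>x. if x \<in> {..1} then 1 + L else s powr (x - 1) * (1 + x * L))"
  have cl: "closure {..1} \<inter> closure {1<..} = {1::real}" by auto
  have deriv: "(f has_real_derivative f' x) (at x)" for x
    unfolding f_def f'_def has_real_derivative_iff_has_vector_derivative
  proof (rule has_vector_derivative_If_within_closures[where T = "{1<..}", unfolded cl])
    show "((\<lambda>x. 1 + (1 + L) * (x - 1)) has_vector_derivative 1 + L) (at x within S)" for S
      unfolding has_real_derivative_iff_has_vector_derivative[symmetric]
      by (auto intro!: derivative_eq_intros)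
    show "((\<lambda>x. x * s powr (x - 1)) has_vector_derivative s powr (x - 1) * (1 + x * L))
        (at x within S)" for S
      unfolding has_real_derivative_iff_has_vector_derivative[symmetric]
      by (rule has_field_derivative_at_within)
        (use s in \<open>auto intro!: derivative_eq_intros simp: L_def algebra_simps\<close>)
  qed (use s in auto)
  have nonpos: "f' x \<le> 0" for x
  proof (cases "x \<le> 1")
    case False
    then have "x * L \<le> 1 * L" using L by (intro mult_right_mono_neg) auto
    with L have "1 + x * L \<le> 0" by linarith
    with False show ?thesis by (simp add: f'_def mult_nonneg_nonpos)
  qed (use L in \<open>simp add: f'_def\<close>)
  \<comment> \<open>The constant \<open>exp (- 2)\<close> originates here: the second derivative
    carries the factor \<open>L * (2 + z * L)\<close>, which is nonnegative for all
    \<open>z \<ge> 1\<close> exactly when \<open>L \<le> -2\<close>, given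
    \<open>L < 0\<close>.\<close>
  have tail: "s powr (x - 1) * (1 + x * L) \<le> s powr (y - 1) * (1 + y * L)"
    if "1 \<le> x" "x \<le> y" for x y
  proof (rule DERIV_nonneg_imp_nondecreasing[OF \<open>x \<le> y\<close>])
    fix z assume z: "x \<le> z" "z \<le> y"
    have "((\<lambda>x. s powr (x - 1) * (1 + x * L)) has_real_derivative
        s powr (z - 1) * (L * (2 + z * L))) (at z)"
      using s by (auto intro!: derivative_eq_intros simp: L_def algebra_simps)
    moreover have "z * L \<le> 1 * L" using L z that by (intro mult_right_mono_neg) auto
    then have "0 \<le> L * (2 + z * L)" using L by (intro mult_nonpos_nonpos) linarith+
    then have "0 \<le> s powr (z - 1) * (L * (2 + z * L))" by (rule mult_nonneg_nonneg[OF powr_ge_zero])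
    ultimately show "\<exists>d. ((\<lambda>x. s powr (x - 1) * (1 + x * L)) has_real_derivative d) (at z) \<and> 0 \<le> d"
      by blast
  qed
  show thesis
  proof
    show "convex_on UNIV f"
    proof (rule convex_on_realI[OF _ deriv])
      fix x y :: real assume "x \<le> y"
      then show "f' x \<le> f' y"
        \<comment> \<open>Left of 1 the slope is constantly \<open>1 + L\<close>, the value of the
          right branch at 1, hence the instance starting at 1.\<close>
        using tail[of 1 y] tail[of x y] s by (auto simp: f'_def)
    qed auto
    show "antimono f"
      using deriv nonpos by (intro antimonoI) (blast intro: DERIV_nonpos_imp_nonincreasing)
    fix k :: nat assume k: "k > 0"
    then show "f (real k) = real k * s ^ (k - 1)"
    proof (cases "k = 1")
      case False
      with k have "real k - 1 = real (k - 1)" by (simp add: of_nat_diff)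
      with False k s show ?thesis by (simp add: f_def powr_realpow del: of_nat_diff)
    qed (simp add: f_def)
  qed
qed

lemma gen_fun_size_bias_le:
  assumes p: "finite_mean p" "mean p \<noteq> 0" and q: "finite_mean q" "mean q \<noteq> 0"
    and icv: "icv_le (map_pmf real p) (map_pmf real q)"
    and zero: "pmf p 0 = pmf q 0"
    and s: "0 \<le> s" "s \<le> exp (- 2)"
  shows "gen_fun (size_bias q) s \<le> gen_fun (size_bias p) s"
proof -
  obtain f :: "real \<Rightarrow> real" where f: "convex_on UNIV f" "antimono f"
    "\<And>k::nat. k > 0 \<Longrightarrow> f (real k) = real k * s ^ (k - 1)"
    using size_bias_test_function[OF s] by blast
  have s1: "s \<le> 1" using s by (meson exp_le_one_iff order_trans neg_le_0_iff_le zero_le_numeral)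
  let ?h = "\<lambda>k. real k * s ^ (k - 1)"
  \<comment> \<open>The value \<open>f 0\<close> is unknown, but it enters both expectations only
    through the mass at 0, which \<open>p\<close> and \<open>q\<close> share.\<close>
  have f_eq: "(\<lambda>k. f (real k)) = (\<lambda>k. ?h k + f 0 * indicator {0} k)"
  proof
    fix k show "f (real k) = ?h k + f 0 * indicator {0} k"
      using f(3)[of k] by (cases "k = 0") auto
  qed
  have int: "integrable (measure_pmf r) (\<lambda>k. f (real k))"
    and E: "measure_pmf.expectation r (\<lambda>k. f (real k)) = measure_pmf.expectation r ?h + f 0 * pmf r 0"
    if "finite_mean r" "mean r \<noteq> 0" for r
    using gen_fun_size_bias(1)[OF that s(1) s1]
    by (simp_all add: f_eq measure_pmf.emeasure_eq_measure pmf.rep_eq)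
  have le: "measure_pmf.expectation q ?h \<le> measure_pmf.expectation p ?h"
    using icv_leD[OF icv f(1,2) int[OF p] int[OF q]] E[OF p] E[OF q] zero by simp
  have "0 < mean p" using p(2) by (simp add: mean_def less_le)
  moreover have "0 \<le> measure_pmf.expectation q ?h" using s by simp
  ultimately have "measure_pmf.expectation q ?h / mean q \<le> measure_pmf.expectation p ?h / mean p"
    using le icv_le_mean_le[OF icv p(1) q(1)] by (intro frac_le) auto
  then show ?thesis using p q s(1) s1 by (simp add: gen_fun_size_bias(2))
qed

theorem theorem4p1:
  fixes p q :: "nat pmf"
  assumes "finite_mean p" and "mean p \<noteq> 0"
    and "finite_mean q" and "mean q \<noteq> 0"
    and "icv_le (map_pmf real p) (map_pmf real q)"
    and "pmf p 0 = pmf q 0"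
    and "eta (size_bias q) \<le> exp (- 2)"
  shows "zeta_CM p \<le> zeta_CM q"
proof -
  have "eta (size_bias q) \<le> eta (size_bias p)"
  proof (rule eta_greatest, rule ccontr)
    fix t assume t: "0 \<le> t" "t \<le> 1" "gen_fun (size_bias p) t = t"
      and less: "\<not> eta (size_bias q) \<le> t"
    \<comment> \<open>Here \<open>t < eta (size_bias q) \<le> exp (- 2)\<close>, so the comparison
      of size-biased generating functions applies at \<open>t\<close>.\<close>
    have "gen_fun (size_bias q) t \<le> t"
      using gen_fun_size_bias_le[OF assms(1-6) t(1)] t(3) less assms(7) by simp
    with t less show False using eta_le_of_gen_fun_le by blast
  qed
  then have "gen_fun p (eta (size_bias q)) \<le> gen_fun p (eta (size_bias p))"
    by (intro gen_fun_mono eta_bounds)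
  moreover have "gen_fun q (eta (size_bias q)) \<le> gen_fun p (eta (size_bias q))"
    by (intro gen_fun_le_of_icv_le assms eta_bounds)
  ultimately show ?thesis by (simp add: zeta_CM_def)
qed

end
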